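(* Let $\rho$ be a density matrix on the $d$-dimensional Hilbert space $\mathbb{C}^d$. Let $\mathbb{P}_2(\rho)=\log_2 d-S_2(\rho)=\log_2\left(d\,\mathrm{Tr}(\rho^2)\right)$ be the Rényi $2$-purity of $\rho$, and let $\mathcal{P}(\rho)=d\left(\mathcal{T}^{\max}(\rho)-\mathcal{T}^{\min}(\rho)\right)$ be its texture-based purity monotone. Then $$\mathbb{P}_2(\rho)\ \ge\ \log_2\left[1+\frac{\mathcal{P}(\rho)^2}{2d}\right].$$ Equality holds in the case of rank-$2$ density matrices, which also incorporates density matrices acting on the two-dimensional Hilbert space $\mathbb{C}^2$.
   Context: A density matrix on $\mathbb{C}^d$ is a positive semidefinite operator of trace $1$. For an orthonormal basis $\mathsf{B}=\{|i\rangle\}_{i=1}^d$ of $\mathbb{C}^d$, the texture of $\rho$ with respect to $\mathsf{B}$ is $$\mathcal{T}_{\mathsf{B}}(\rho)=1-\frac1d\sum_{i,j=1}^d\langle i|\rho|j\rangle = 1-\langle s_1|\rho|s_1\rangle,\qquad |s_1\rangle=\frac{1}{\sqrt d}\sum_{i=1}^d|i\rangle .$$ $\mathcal{T}^{\max}(\rho)$ and $\mathcal{T}^{\min}(\rho)$ denote the maximum and the minimum of $\mathcal{T}_{\mathsf{B}}(\rho)$ over all orthonormal bases $\mathsf{B}$ of $\mathbb{C}^d$. The Rényi $2$-entropy is $S_2(\rho)=-\log_2\mathrm{Tr}(\rho^2)$.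
   Formalization: Equality for rank-2 density matrices is false in general for d>2 (d=4, diag(1/2,1/2,0,0)). It is proved for all density matrices on C^2 and, for rank-2 ρ in any d, for ρ restricted to its two-dimensional support, with 2 in place of d. *)

theory Defs
  imports Complex_Main
    "Jordan_Normal_Form.Schur_Decomposition"
    "Jordan_Normal_Form.DL_Rank"
begin

definition mtrace :: "complex mat \<Rightarrow> complex" where
  "mtrace A = (\<Sum>i<dim_row A. A $$ (i, i))"

definition density_matrix :: "nat \<Rightarrow> complex mat \<Rightarrow> bool" where
  "density_matrix d \<rho> \<longleftrightarrow>
     \<rho> \<in> carrier_mat d d \<and> mat_adjoint \<rho> = \<rho> \<and>
     (\<forall>v \<in> carrier_vec d. 0 \<le> Re ((\<rho> *\<^sub>v v) \<bullet>c v)) \<and>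
     mtrace \<rho> = 1"

(* Vectors b 0, ..., b (d - 1); spanning is automatic for d orthonormal vectors. *)
definition orthonormal_basis :: "nat \<Rightarrow> (nat \<Rightarrow> complex vec) \<Rightarrow> bool" where
  "orthonormal_basis d b \<longleftrightarrow>
     (\<forall>i<d. b i \<in> carrier_vec d) \<and>
     (\<forall>i<d. \<forall>j<d. b i \<bullet>c b j = (if i = j then 1 else 0))"

(* v \<bullet>c w conjugates w, so (\<rho> *\<^sub>v b j) \<bullet>c b i is the matrix element <i|\<rho>|j>.
   For Hermitian \<rho> the double sum is real, and Re only changes its type. *)
definition texture :: "nat \<Rightarrow> (nat \<Rightarrow> complex vec) \<Rightarrow> complex mat \<Rightarrow> real" where
  "texture d b \<rho> =
     1 - (1 / real d) * Re (\<Sum>i<d. \<Sum>j<d. (\<rho> *\<^sub>v b j) \<bullet>c b i)"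

definition texture_max :: "nat \<Rightarrow> complex mat \<Rightarrow> real" where
  "texture_max d \<rho> = (GREATEST t. \<exists>b. orthonormal_basis d b \<and> t = texture d b \<rho>)"

definition texture_min :: "nat \<Rightarrow> complex mat \<Rightarrow> real" where
  "texture_min d \<rho> = (LEAST t. \<exists>b. orthonormal_basis d b \<and> t = texture d b \<rho>)"

definition texture_purity :: "nat \<Rightarrow> complex mat \<Rightarrow> real" where
  "texture_purity d \<rho> = real d * (texture_max d \<rho> - texture_min d \<rho>)"

definition renyi2_entropy :: "complex mat \<Rightarrow> real" where
  "renyi2_entropy \<rho> = - log 2 (Re (mtrace (\<rho> * \<rho>)))"

definition renyi2_purity :: "nat \<Rightarrow> complex mat \<Rightarrow> real" where
  "renyi2_purity d \<rho> = log 2 (real d) - renyi2_entropy \<rho>"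

(* V is an isometry from C^r into C^d whose range contains the range of \<rho>, and
   \<sigma> is \<rho> regarded as an operator on that r-dimensional subspace. If r is the
   rank of \<rho>, the subspace is the support of \<rho>. *)
definition restricts_to :: "nat \<Rightarrow> nat \<Rightarrow> complex mat \<Rightarrow> complex mat \<Rightarrow> bool" where
  "restricts_to d r \<rho> \<sigma> \<longleftrightarrow>
     (\<exists>V \<in> carrier_mat d r. mat_adjoint V * V = 1\<^sub>m r \<and>
        V * mat_adjoint V * \<rho> = \<rho> \<and> \<sigma> = mat_adjoint V * \<rho> * V)"

lemma mtrace_square_pos:
  assumes "density_matrix d \<rho>"
  shows "0 < Re (mtrace (\<rho> * \<rho>))"
proof -
  have c: "\<rho> \<in> carrier_mat d d" and h: "mat_adjoint \<rho> = \<rho>" and t: "mtrace \<rho> = 1"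
    using assms by (auto simp: density_matrix_def)
  have herm: "\<rho> $$ (j, i) = cnj (\<rho> $$ (i, j))" if "i < d" "j < d" for i j
  proof -
    have "mat_adjoint \<rho> $$ (j, i) = cnj (\<rho> $$ (i, j))"
      using that c by (simp add: mat_adjoint_def mat_of_rows_def)
    then show ?thesis using h by simp
  qed
  have "mtrace (\<rho> * \<rho>) = (\<Sum>i<d. \<Sum>j<d. \<rho> $$ (i, j) * \<rho> $$ (j, i))"
    using c by (auto simp: mtrace_def scalar_prod_def atLeast0LessThan intro!: sum.cong)
  also have "\<dots> = (\<Sum>i<d. \<Sum>j<d. complex_of_real ((cmod (\<rho> $$ (i, j)))\<^sup>2))"
  proof (intro sum.cong refl)
    fix i j assume "i \<in> {..<d}" "j \<in> {..<d}"
    then have "\<rho> $$ (j, i) = cnj (\<rho> $$ (i, j))" by (intro herm) auto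
    then show "\<rho> $$ (i, j) * \<rho> $$ (j, i) = complex_of_real ((cmod (\<rho> $$ (i, j)))\<^sup>2)"
      by (metis complex_norm_square)
  qed
  finally have eq: "Re (mtrace (\<rho> * \<rho>)) = (\<Sum>i<d. \<Sum>j<d. (cmod (\<rho> $$ (i, j)))\<^sup>2)"
    by simp
  have "\<exists>i<d. \<rho> $$ (i, i) \<noteq> 0"
  proof (rule ccontr)
    assume "\<not> ?thesis"
    then have "mtrace \<rho> = 0" using c by (simp add: mtrace_def)
    then show False using t by simp
  qed
  then obtain i where i: "i < d" "\<rho> $$ (i, i) \<noteq> 0" by blast
  have "0 < (cmod (\<rho> $$ (i, i)))\<^sup>2" using i by simp
  also have "\<dots> \<le> (\<Sum>j<d. (cmod (\<rho> $$ (i, j)))\<^sup>2)"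
    using i by (intro member_le_sum) auto
  also have "\<dots> \<le> (\<Sum>i<d. \<Sum>j<d. (cmod (\<rho> $$ (i, j)))\<^sup>2)"
    using i by (intro member_le_sum[where f = "\<lambda>i. \<Sum>j<d. (cmod (\<rho> $$ (i, j)))\<^sup>2"])
      (auto intro: sum_nonneg)
  finally show ?thesis using eq by simp
qed

lemma renyi2_purity_eq:
  assumes "density_matrix d \<rho>"
  shows "renyi2_purity d \<rho> = log 2 (real d * Re (mtrace (\<rho> * \<rho>)))"
proof -
  have "d \<noteq> 0"
  proof
    assume "d = 0"
    then show False using assms by (auto simp: density_matrix_def mtrace_def)
  qed
  then show ?thesis
    using mtrace_square_pos[OF assms]
    by (simp add: renyi2_purity_def renyi2_entropy_def log_mult)
qed

end

theory Submission
  imports Defs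
begin

text \<open>
  A basis enters the texture only through the sum of its vectors, a vector of squared norm \<open>d\<close>,
  and every eigenvector direction arises as such a sum. Hence the extreme textures are
  \<open>1 - \<lambda>\<close> for the extreme eigenvalues \<open>\<lambda>\<close> of \<open>\<rho>\<close>. The inequality bounds the variance of the
  spectrum from below by the contribution of the largest and the smallest eigenvalue; for
  \<open>d = 2\<close> there are no others. In rank 2, the restriction of \<open>\<rho>\<close> to its support is a density
  matrix on a two-dimensional space, so the case \<open>d = 2\<close> applies to it.
\<close>

section \<open>Adjoints, traces and families of vectors as matrices\<close>

lemma index_mat_adjoint [simp]:
  fixes A :: "complex mat"
  assumes "i < dim_col A" "j < dim_row A"
  shows "mat_adjoint A $$ (i, j) = cnj (A $$ (j, i))"
  using assms by (simp add: mat_adjoint_def mat_of_rows_def)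

lemma mat_adjoint_dims [simp]:
  "dim_row (mat_adjoint A) = dim_col A" "dim_col (mat_adjoint A) = dim_row A"
  by (simp_all add: mat_adjoint_def mat_of_rows_def)

lemma mat_adjoint_carrier [simp, intro]:
  "A \<in> carrier_mat n m \<Longrightarrow> mat_adjoint A \<in> carrier_mat m n"
  by (rule carrier_matI) simp_all

lemma mat_adjoint_adjoint [simp]:
  fixes A :: "complex mat"
  shows "mat_adjoint (mat_adjoint A) = A"
  by (rule eq_matI) auto

lemma mat_adjoint_mult:
  fixes A B :: "complex mat"
  assumes "A \<in> carrier_mat n m" "B \<in> carrier_mat m k"
  shows "mat_adjoint (A * B) = mat_adjoint B * mat_adjoint A"
  using assms by (intro eq_matI) (auto simp: scalar_prod_def mult.commute)

lemma cscalar_prod_adjoint: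
  fixes A :: "complex mat"
  assumes A: "A \<in> carrier_mat n m" and x: "x \<in> carrier_vec m" and y: "y \<in> carrier_vec n"
  shows "(A *\<^sub>v x) \<bullet>c y = x \<bullet>c (mat_adjoint A *\<^sub>v y)"
proof -
  have "(A *\<^sub>v x) \<bullet>c y = (\<Sum>i<n. \<Sum>j<m. A $$ (i, j) * x $ j * cnj (y $ i))"
    using assms by (auto simp: scalar_prod_def sum_distrib_right atLeast0LessThan intro!: sum.cong)
  also have "\<dots> = (\<Sum>j<m. \<Sum>i<n. A $$ (i, j) * x $ j * cnj (y $ i))"
    by (rule sum.swap)
  also have "\<dots> = x \<bullet>c (mat_adjoint A *\<^sub>v y)"
    using assms
    by (auto simp: scalar_prod_def sum_distrib_left atLeast0LessThan ac_simps intro!: sum.cong)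
  finally show ?thesis .
qed

text \<open>Both products give the same double sum. The factors may be rectangular, so that the
  trace of \<open>V * mat_adjoint V\<close> for an isometry \<open>V\<close> can be read off from a
  smaller identity matrix.\<close>

lemma mtrace_mult_commute:
  assumes "A \<in> carrier_mat n m" "B \<in> carrier_mat m n"
  shows "mtrace (A * B) = mtrace (B * A)"
proof -
  have "mtrace (A * B) = (\<Sum>i<n. \<Sum>j<m. A $$ (i, j) * B $$ (j, i))"
    using assms by (auto simp: mtrace_def scalar_prod_def atLeast0LessThan intro!: sum.cong)
  also have "\<dots> = (\<Sum>j<m. \<Sum>i<n. A $$ (i, j) * B $$ (j, i))"
    by (rule sum.swap)
  also have "\<dots> = mtrace (B * A)"
    using assms
    by (auto simp: mtrace_def scalar_prod_def atLeast0LessThan ac_simps intro!: sum.cong)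
  finally show ?thesis .
qed

text \<open>With the family as a matrix, orthonormality becomes one matrix equation, and the sum of
  the family becomes the image of the all-ones vector.\<close>

definition columns :: "nat \<Rightarrow> nat \<Rightarrow> (nat \<Rightarrow> complex vec) \<Rightarrow> complex mat" where
  "columns n k u = mat n k (\<lambda>(i, j). u j $ i)"

lemma columns_carrier [simp]: "columns n k u \<in> carrier_mat n k"
  by (simp add: columns_def)

lemma columns_dims [simp]: "dim_row (columns n k u) = n" "dim_col (columns n k u) = k"
  by (simp_all add: columns_def)

lemma col_columns [simp]: "j < k \<Longrightarrow> u j \<in> carrier_vec n \<Longrightarrow> col (columns n k u) j = u j"
  by (auto simp: columns_def)

lemma columns_col: "A \<in> carrier_mat n k \<Longrightarrow> columns n k (col A) = A"
  by (rule eq_matI) (auto simp: columns_def)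

text \<open>These are the entries of a Gram matrix. The two columns appear in reversed order because
  \<open>\<bullet>c\<close> conjugates its right argument.\<close>

lemma index_adjoint_mult_col:
  fixes A B :: "complex mat"
  assumes "A \<in> carrier_mat n m" "B \<in> carrier_mat n k" "i < m" "j < k"
  shows "(mat_adjoint A * B) $$ (i, j) = col B j \<bullet>c col A i"
  using assms by (auto simp: scalar_prod_def ac_simps intro!: sum.cong)

lemma adjoint_columns_mult_columns:
  assumes "\<And>i. i < k \<Longrightarrow> u i \<in> carrier_vec n"
  shows "mat_adjoint (columns n k u) * columns n k u = 1\<^sub>m k \<longleftrightarrow>
    (\<forall>i<k. \<forall>j<k. u i \<bullet>c u j = (if i = j then 1 else 0))"
proof -
  have "(mat_adjoint (columns n k u) * columns n k u) $$ (i, j) = u j \<bullet>c u i"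
    if "i < k" "j < k" for i j
    using that assms by (subst index_adjoint_mult_col[where n = n and m = k and k = k]) auto
  then show ?thesis
    by (auto simp: mat_eq_iff)
qed

lemma orthonormal_basis_iff:
  "orthonormal_basis n u \<longleftrightarrow>
    (\<forall>i<n. u i \<in> carrier_vec n) \<and> mat_adjoint (columns n n u) * columns n n u = 1\<^sub>m n"
  using adjoint_columns_mult_columns[of n u n] by (auto simp: orthonormal_basis_def)

lemma mtrace_one: "mtrace (1\<^sub>m n) = of_nat n"
  by (simp add: mtrace_def)

lemma vec_norm_square:
  fixes v :: "complex vec"
  shows "v \<bullet>c v = complex_of_real (\<Sum>i<dim_vec v. (cmod (v $ i))\<^sup>2)"
  by (simp add: scalar_prod_def atLeast0LessThan complex_norm_square del: of_real_power)

lemma exists_normalized: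
  fixes w :: "complex vec"
  assumes "w \<in> carrier_vec n" "w \<noteq> 0\<^sub>v n"
  obtains c where "c \<noteq> 0" "(c \<cdot>\<^sub>v w) \<bullet>c (c \<cdot>\<^sub>v w) = 1"
proof -
  define r where "r = (\<Sum>i<n. (cmod (w $ i))\<^sup>2)"
  have eq: "w \<bullet>c w = complex_of_real r"
    using assms vec_norm_square[of w] by (simp add: r_def)
  have "r \<ge> 0" by (simp add: r_def sum_nonneg)
  moreover have "r \<noteq> 0" using eq assms conjugate_square_eq_0_vec[of w n] by auto
  ultimately have r: "r > 0" by simp
  have "(complex_of_real (1 / sqrt r) \<cdot>\<^sub>v w) \<bullet>c (complex_of_real (1 / sqrt r) \<cdot>\<^sub>v w)
      = complex_of_real (1 / sqrt r) * (complex_of_real (1 / sqrt r) * (w \<bullet>c w))"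
    using assms by (simp add: conjugate_smult_vec)
  also have "\<dots> = complex_of_real (1 / sqrt r * (1 / sqrt r) * r)"
    unfolding eq of_real_mult by simp
  also have "1 / sqrt r * (1 / sqrt r) * r = 1"
    using r by (simp add: field_simps)
  finally show ?thesis using r by (intro that[of "complex_of_real (1 / sqrt r)"]) auto
qed

section \<open>Orthonormal eigenvectors of a Hermitian matrix\<close>

text \<open>
  The Schur decomposition of the library has no unitarity statement. It does provide a flag
  \<open>span {p\<^sub>0, \<dots>, p\<^sub>j}\<close> of invariant subspaces. The orthogonal projection onto the complement of
  the eigenvectors found so far commutes with the Hermitian matrix, so the first \<open>p\<^sub>j\<close> with a
  nonzero projection projects to an eigenvector.
\<close>

lemma hermitian_next_eigenvector:
  fixes A :: "complex mat"
  assumes A: "A \<in> carrier_mat n n" and herm: "mat_adjoint A = A"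
    and V: "V \<in> carrier_mat n k" and D: "D \<in> carrier_mat k k"
    and iso: "mat_adjoint V * V = 1\<^sub>m k" and inv: "A * V = V * D" and "k < n"
  obtains w \<mu> where "w \<in> carrier_vec n" "w \<noteq> 0\<^sub>v n" "A *\<^sub>v w = \<mu> \<cdot>\<^sub>v w"
    "mat_adjoint V *\<^sub>v w = 0\<^sub>v k"
proof -
  obtain es where "char_poly A = (\<Prod>a\<leftarrow>es. [:- a, 1:])"
    using char_poly_factorized[OF A] by blast
  moreover obtain B P Q where "schur_decomposition A es = (B, P, Q)"
    by (cases "schur_decomposition A es") auto
  ultimately have sim: "similar_mat_wit A B P Q" and ut: "upper_triangular B"
    using schur_decomposition[OF A] by blast+
  note PQ = similar_mat_witD2[OF A sim]
  note [simp] = PQ(5,6,7) A V D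
  have AP: "A * P = P * B"
  proof -
    have "A * P = P * B * Q * P" using PQ(3) by simp
    also have "\<dots> = P * B * (Q * P)"
      by (rule assoc_mult_mat[OF mult_carrier_mat[OF PQ(6,5)] PQ(7,6)])
    also have "\<dots> = P * B" unfolding PQ(2) 
      by (rule right_mult_one_mat[OF mult_carrier_mat[OF PQ(6,5)]])
    finally show ?thesis .
  qed
  \<comment> \<open>\<open>R\<close> is the orthogonal projection onto the range of
    \<open>V\<close>, and \<open>K\<close> is the projection onto its orthogonal complement.\<close>
  define R where "R = V * mat_adjoint V"
  define K where "K = 1\<^sub>m n - R"
  have R [simp]: "R \<in> carrier_mat n n"
    unfolding R_def by (rule mult_carrier_mat[OF V mat_adjoint_carrier[OF V]])
  have K [simp]: "K \<in> carrier_mat n n"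
    unfolding K_def by (rule minus_carrier_mat[OF R])
  \<comment> \<open>The equation \<open>A * V = V * D\<close> determines \<open>D\<close> as the
    compression of \<open>A\<close> to the range of \<open>V\<close>, so \<open>D\<close> inherits
    being Hermitian. Taking adjoints of that equation then makes the complement invariant too, which
    is why \<open>A\<close> commutes with \<open>R\<close> and \<open>K\<close>.\<close>
  have "mat_adjoint V * A * V = mat_adjoint V * (A * V)"
    by (rule assoc_mult_mat[of _ k n _ n _ k]) auto
  also have "\<dots> = mat_adjoint V * V * D"
    unfolding inv by (rule assoc_mult_mat[of _ k n _ k _ k, symmetric]) auto
  finally have Deq: "D = mat_adjoint V * A * V"
    unfolding iso left_mult_one_mat[OF D] ..
  have "mat_adjoint (mat_adjoint V * (A * V)) = mat_adjoint (A * V) * V"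
    by (subst mat_adjoint_mult[OF mat_adjoint_carrier[OF V] mult_carrier_mat[OF A V]]) simp
  also have "mat_adjoint (A * V) = mat_adjoint V * A"
    by (subst mat_adjoint_mult[of _ n n _ k]) (auto simp: herm)
  finally have Dherm: "mat_adjoint D = D"
    unfolding Deq by (simp add: assoc_mult_mat[of _ k n _ n _ k])
  have VA: "mat_adjoint V * A = D * mat_adjoint V"
  proof -
    have "mat_adjoint V * A = mat_adjoint (A * V)"
      by (subst mat_adjoint_mult[of _ n n _ k]) (auto simp: herm)
    also have "\<dots> = D * mat_adjoint V"
      unfolding inv by (subst mat_adjoint_mult[of _ n k _ k]) (auto simp: Dherm)
    finally show ?thesis .
  qed
  have "A * R = A * V * mat_adjoint V"
    unfolding R_def by (rule assoc_mult_mat[of _ n n _ k _ n, symmetric]) auto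
  also have "\<dots> = V * (D * mat_adjoint V)"
    unfolding inv by (rule assoc_mult_mat[of _ n k _ k _ n]) auto
  also have "\<dots> = R * A"
    unfolding R_def VA[symmetric] by (rule assoc_mult_mat[of _ n k _ n _ n, symmetric]) auto
  finally have AR: "A * R = R * A" .
  have AK: "A * K = K * A"
    unfolding K_def using AR
    by (simp add: mult_minus_distrib_mat[of _ n n _ n] minus_mult_distrib_mat[of _ n n _ _ n]
        left_mult_one_mat[OF A] right_mult_one_mat[OF A])
  define W where "W = K * P"
  have W [simp]: "W \<in> carrier_mat n n"
    unfolding W_def by (rule mult_carrier_mat[OF K PQ(6)])
  note [simp] = carrier_matD[OF W] carrier_matD[OF A] carrier_matD[OF PQ(5)]
  have "A * W = K * A * P"
    unfolding W_def AK[symmetric] by (rule assoc_mult_mat[of _ n n _ n _ n, symmetric]) auto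
  also have "\<dots> = K * (P * B)"
    unfolding AP[symmetric] by (rule assoc_mult_mat[of _ n n _ n _ n]) auto
  also have "\<dots> = W * B"
    unfolding W_def by (rule assoc_mult_mat[of _ n n _ n _ n, symmetric]) auto
  finally have AW: "A * W = W * B" .
  have VK: "mat_adjoint V * K = 0\<^sub>m k n"
  proof -
    have "mat_adjoint V * R = mat_adjoint V * V * mat_adjoint V"
      unfolding R_def by (rule assoc_mult_mat[of _ k n _ k _ n, symmetric]) auto
    then have "mat_adjoint V * R = mat_adjoint V"
      unfolding iso left_mult_one_mat[OF mat_adjoint_carrier[OF V]] .
    then show ?thesis
      unfolding K_def
      by (simp add: mult_minus_distrib_mat[of _ k n _ n] right_mult_one_mat[OF mat_adjoint_carrier[OF V]]
          minus_r_inv_mat[OF mat_adjoint_carrier[OF V]])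
  qed
  have VW: "mat_adjoint V * W = 0\<^sub>m k n"
  proof -
    have "mat_adjoint V * W = mat_adjoint V * K * P"
      unfolding W_def by (rule assoc_mult_mat[of _ k n _ n _ n, symmetric]) auto
    then show ?thesis unfolding VK left_mult_zero_mat[OF PQ(6)] .
  qed
  \<comment> \<open>If every column of \<open>K * P\<close> vanished, invertibility of
    \<open>P\<close> would give \<open>K = 0\<close> and hence \<open>R = 1\<close>. The trace of
    \<open>R\<close> is \<open>k\<close>, however, and \<open>k < n\<close>.\<close>
  have "\<exists>j<n. col W j \<noteq> 0\<^sub>v n"
  proof (rule ccontr)
    assume "\<not> ?thesis"
    then have cz: "col W j = 0\<^sub>v n" if "j < n" for j using that by blast
    have "W = 0\<^sub>m n n"
    proof (rule eq_matI)
      fix i j assume "i < dim_row (0\<^sub>m n n :: complex mat)" "j < dim_col (0\<^sub>m n n :: complex mat)"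
      then have ij: "i < n" "j < n" by auto
      have "W $$ (i, j) = col W j $ i"
        using ij carrier_matD[OF W] by simp
      then show "W $$ (i, j) = 0\<^sub>m n n $$ (i, j)" using ij cz by simp
    qed (use carrier_matD[OF W] in auto)
    moreover have "W * Q = K"
    proof -
      have "W * Q = K * (P * Q)"
        unfolding W_def by (rule assoc_mult_mat[of _ n n _ n _ n]) auto
      then show ?thesis unfolding PQ(1) right_mult_one_mat[OF K] .
    qed
    ultimately have K0: "K = 0\<^sub>m n n" using left_mult_zero_mat[OF PQ(7)] by simp
    have "R = 1\<^sub>m n"
    proof (rule eq_matI)
      fix i j assume "i < dim_row (1\<^sub>m n :: complex mat)" "j < dim_col (1\<^sub>m n :: complex mat)"
      then have ij: "i < n" "j < n" by auto
      have "K $$ (i, j) = 1\<^sub>m n $$ (i, j) - R $$ (i, j)"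
        unfolding K_def using ij carrier_matD[OF R] by simp
      then show "R $$ (i, j) = 1\<^sub>m n $$ (i, j)" using K0 ij by simp
    qed (use carrier_matD[OF R] in auto)
    moreover have "mtrace R = mtrace (mat_adjoint V * V)"
      unfolding R_def by (rule mtrace_mult_commute[of _ n k]) auto
    ultimately have "of_nat n = (of_nat k :: complex)"
      unfolding iso by (simp add: mtrace_one)
    then show False using \<open>k < n\<close> by simp
  qed
  then obtain j where j: "j < n" "col W j \<noteq> 0\<^sub>v n"
    and least: "\<And>i. i < j \<Longrightarrow> \<not> (i < n \<and> col W i \<noteq> 0\<^sub>v n)"
    using exists_least_iff[of "\<lambda>j. j < n \<and> col W j \<noteq> 0\<^sub>v n"] by blast
  have zero: "W $$ (l, i) = 0" if "i < j" "l < n" for l i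
  proof -
    have "col W i $ l = 0" using that least[of i] j by auto
    then show ?thesis using that j carrier_matD[OF W] by simp
  qed
  have eig: "A *\<^sub>v col W j = B $$ (j, j) \<cdot>\<^sub>v col W j"
  proof (rule eq_vecI)
    fix l assume "l < dim_vec (B $$ (j, j) \<cdot>\<^sub>v col W j)"
    then have l: "l < n" by simp
    have "(A *\<^sub>v col W j) $ l = (A * W) $$ (l, j)"
      using l j by simp
    also have "\<dots> = (\<Sum>i<n. W $$ (l, i) * B $$ (i, j))"
      unfolding AW using l j by (simp add: scalar_prod_def atLeast0LessThan)
    \<comment> \<open>Only the diagonal term survives: entries of \<open>B\<close> with
      \<open>i > j\<close> vanish by triangularity, and columns of \<open>W\<close> with
      \<open>i < j\<close> vanish by the minimal choice of \<open>j\<close>.\<close>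
    also have "\<dots> = (\<Sum>i\<in>{j}. W $$ (l, i) * B $$ (i, j))"
    proof (rule sum.mono_neutral_right)
      show "\<forall>i\<in>{..<n} - {j}. W $$ (l, i) * B $$ (i, j) = 0"
      proof
        fix i assume i: "i \<in> {..<n} - {j}"
        show "W $$ (l, i) * B $$ (i, j) = 0"
        proof (cases "i < j")
          case True
          then show ?thesis using zero l by simp
        next
          case False
          then have "B $$ (i, j) = 0"
            using i by (intro upper_triangularD[OF ut]) auto
          then show ?thesis by simp
        qed
      qed
    qed (use j in auto)
    finally show "(A *\<^sub>v col W j) $ l = (B $$ (j, j) \<cdot>\<^sub>v col W j) $ l"
      using l j by simp
  qed simp
  have "mat_adjoint V *\<^sub>v col W j = col (mat_adjoint V * W) j"
    using j by (subst col_mult2[of _ k n _ n]) auto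
  also have "\<dots> = 0\<^sub>v k"
    unfolding VW using j by simp
  finally show ?thesis
    using that[of "col W j"] j eig by (metis W carrier_matD(1) col_dim)
qed

text \<open>By induction on \<open>k\<close>: the eigenvectors found so far form an isometry
  \<open>V\<close> with \<open>A * V = V * D\<close> for a diagonal \<open>D\<close>, so a further
  eigenvector orthogonal to all of them exists and only needs to be normalized.\<close>

lemma hermitian_orthonormal_eigenvectors:
  fixes A :: "complex mat"
  assumes A: "A \<in> carrier_mat n n" and herm: "mat_adjoint A = A" and "k \<le> n"
  shows "\<exists>u \<mu>. (\<forall>i<k. u i \<in> carrier_vec n \<and> A *\<^sub>v u i = \<mu> i \<cdot>\<^sub>v u i) \<and>
    (\<forall>i<k. \<forall>j<k. u i \<bullet>c u j = (if i = j then 1 else 0))"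
  using \<open>k \<le> n\<close>
proof (induction k)
  case 0
  then show ?case by simp
next
  case (Suc k)
  then have "k \<le> n" by simp
  from Suc.IH[OF this] obtain u \<mu> where u: "\<And>i. i < k \<Longrightarrow> u i \<in> carrier_vec n"
    and eig: "\<And>i. i < k \<Longrightarrow> A *\<^sub>v u i = \<mu> i \<cdot>\<^sub>v u i"
    and orth: "\<And>i j. i < k \<Longrightarrow> j < k \<Longrightarrow> u i \<bullet>c u j = (if i = j then 1 else 0)"
    by blast
  define V where "V = columns n k u"
  have V: "V \<in> carrier_mat n k" by (simp add: V_def)
  have iso: "mat_adjoint V * V = 1\<^sub>m k"
    unfolding V_def using adjoint_columns_mult_columns[of k u n] u orth by blast
  have inv: "A * V = V * mat_diag k \<mu>"
  proof (subst mat_diag_mult_right[OF V], rule eq_matI, goal_cases)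
    case (1 i j)
    then have ij: "i < n" "j < k" by auto
    have "(A * V) $$ (i, j) = (A *\<^sub>v u j) $ i"
      using ij A u by (simp add: V_def)
    then show ?case
      using ij carrier_vecD[OF u] by (simp add: eig V_def columns_def)
  qed (use A V in auto)
  obtain w \<nu> where w: "w \<in> carrier_vec n" "w \<noteq> 0\<^sub>v n" "A *\<^sub>v w = \<nu> \<cdot>\<^sub>v w"
    and Vw: "mat_adjoint V *\<^sub>v w = 0\<^sub>v k"
    using hermitian_next_eigenvector[OF A herm V mat_diag_dim iso inv] Suc.prems
    by (metis Suc_le_lessD)
  have perp: "w \<bullet>c u i = 0" if "i < k" for i
  proof -
    have "(mat_adjoint V *\<^sub>v w) $ i = row (mat_adjoint V) i \<bullet> w"
      using that V by simp
    also have "row (mat_adjoint V) i = conjugate (u i)"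
      using that carrier_vecD[OF u] by (intro eq_vecI) (auto simp: V_def columns_def)
    also have "conjugate (u i) \<bullet> w = w \<bullet>c u i"
      using that u w by (intro conjugate_vec_sprod_comm[symmetric]) auto
    finally show ?thesis using Vw that by simp
  qed
  have perp': "u i \<bullet>c w = 0" if "i < k" for i
  proof -
    have "u i \<bullet>c w = conjugate (w \<bullet>c u i)"
      using that u w conjugate_conjugate_sprod[of "u i" n w] conjugate_vec_sprod_comm[of w n "u i"]
      by simp
    then show ?thesis using perp[OF that] by simp
  qed
  obtain c where c: "(c \<cdot>\<^sub>v w) \<bullet>c (c \<cdot>\<^sub>v w) = 1"
    using exists_normalized[OF w(1,2)] by blast
  have "\<forall>i<Suc k. (u(k := c \<cdot>\<^sub>v w)) i \<in> carrier_vec n \<and>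
      A *\<^sub>v (u(k := c \<cdot>\<^sub>v w)) i = (\<mu>(k := \<nu>)) i \<cdot>\<^sub>v (u(k := c \<cdot>\<^sub>v w)) i"
    using A w u eig by (auto simp: less_Suc_eq mult_mat_vec smult_smult_assoc mult.commute)
  moreover have "\<forall>i<Suc k. \<forall>j<Suc k.
      (u(k := c \<cdot>\<^sub>v w)) i \<bullet>c (u(k := c \<cdot>\<^sub>v w)) j = (if i = j then 1 else 0)"
    using c w u orth perp perp'
    by (auto simp: less_Suc_eq conjugate_smult_vec)
  ultimately show ?case by blast
qed

section \<open>Spectral decomposition, traces and quadratic forms\<close>

text \<open>The eigenvalues have type \<open>real\<close>, so that \<open>Min\<close> and
  \<open>Max\<close> apply to them directly.\<close>

definition eigenbasis :: "nat \<Rightarrow> complex mat \<Rightarrow> (nat \<Rightarrow> complex vec) \<Rightarrow> (nat \<Rightarrow> real) \<Rightarrow> bool" where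
  "eigenbasis n A u l \<longleftrightarrow> orthonormal_basis n u \<and>
     (\<forall>i<n. A *\<^sub>v u i = complex_of_real (l i) \<cdot>\<^sub>v u i)"

lemma hermitian_eigenbasis:
  fixes A :: "complex mat"
  assumes A: "A \<in> carrier_mat n n" and herm: "mat_adjoint A = A"
  obtains u l where "eigenbasis n A u l"
proof -
  obtain u \<mu> where u: "\<And>i. i < n \<Longrightarrow> u i \<in> carrier_vec n"
    and eig: "\<And>i. i < n \<Longrightarrow> A *\<^sub>v u i = \<mu> i \<cdot>\<^sub>v u i"
    and orth: "\<And>i j. i < n \<Longrightarrow> j < n \<Longrightarrow> u i \<bullet>c u j = (if i = j then 1 else 0)"
    using hermitian_orthonormal_eigenvectors[OF A herm order_refl] by blast
  \<comment> \<open>Moving the Hermitian \<open>A\<close> across the scalar product shows that each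
    eigenvalue equals its own conjugate.\<close>
  have "\<mu> i = complex_of_real (Re (\<mu> i))" if i: "i < n" for i
  proof -
    have "(A *\<^sub>v u i) \<bullet>c u i = u i \<bullet>c (A *\<^sub>v u i)"
      using cscalar_prod_adjoint[OF A u[OF i] u[OF i]] herm by simp
    then have "\<mu> i = cnj (\<mu> i)"
      using u[OF i] orth[OF i i] unfolding eig[OF i] by (simp add: conjugate_smult_vec)
    then show ?thesis by (metis Reals_cnj_iff of_real_Re)
  qed
  then have "eigenbasis n A u (\<lambda>i. Re (\<mu> i))"
    using u eig orth by (auto simp: eigenbasis_def orthonormal_basis_def)
  then show ?thesis by (rule that)
qed

text \<open>The spectral theorem in matrix form. Since \<open>U\<close> is square, its left inverse
  is also a right inverse, which turns \<open>A * U = U * D\<close> into a factorization of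
  \<open>A\<close>.\<close>

lemma eigenbasis_decomposition:
  assumes A: "A \<in> carrier_mat n n" and "eigenbasis n A u l"
  defines "U \<equiv> columns n n u"
  shows "mat_adjoint U * U = 1\<^sub>m n" "U * mat_adjoint U = 1\<^sub>m n"
    "A * U = U * mat_diag n (\<lambda>i. complex_of_real (l i))"
    "A = U * mat_diag n (\<lambda>i. complex_of_real (l i)) * mat_adjoint U"
proof -
  have U: "U \<in> carrier_mat n n" by (simp add: U_def)
  have u: "\<And>i. i < n \<Longrightarrow> u i \<in> carrier_vec n"
    using assms by (auto simp: eigenbasis_def orthonormal_basis_def)
  show 1: "mat_adjoint U * U = 1\<^sub>m n"
    using assms by (auto simp: eigenbasis_def orthonormal_basis_iff)
  show 2: "U * mat_adjoint U = 1\<^sub>m n"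
    by (rule mat_mult_left_right_inverse[OF mat_adjoint_carrier[OF U] U 1])
  show 3: "A * U = U * mat_diag n (\<lambda>i. complex_of_real (l i))"
  proof (subst mat_diag_mult_right[OF U], rule eq_matI, goal_cases)
    case (1 i j)
    then have ij: "i < n" "j < n" by auto
    have "(A * U) $$ (i, j) = (A *\<^sub>v u j) $ i"
      using ij A u by (simp add: U_def)
    then show ?case
      using ij carrier_vecD[OF u] assms(2) by (simp add: eigenbasis_def U_def columns_def)
  qed (use A U in auto)
  have "A = A * (U * mat_adjoint U)"
    unfolding 2 by (rule right_mult_one_mat[OF A, symmetric])
  also have "\<dots> = A * U * mat_adjoint U"
    by (rule assoc_mult_mat[OF A U mat_adjoint_carrier[OF U], symmetric])
  finally show "A = U * mat_diag n (\<lambda>i. complex_of_real (l i)) * mat_adjoint U"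
    unfolding 3 .
qed

lemma mtrace_conjugate_unitary:
  assumes "U \<in> carrier_mat n n" "mat_adjoint U * U = 1\<^sub>m n" "D \<in> carrier_mat n n"
  shows "mtrace (U * D * mat_adjoint U) = mtrace D"
proof -
  have "mtrace (U * D * mat_adjoint U) = mtrace (mat_adjoint U * (U * D))"
    using assms by (intro mtrace_mult_commute[of _ n n]) auto
  also have "mat_adjoint U * (U * D) = mat_adjoint U * U * D"
    using assms by (intro assoc_mult_mat[of _ n n _ n _ n, symmetric]) auto
  finally show ?thesis using assms by simp
qed

lemma mtrace_mat_diag: "mtrace (mat_diag n f) = (\<Sum>i<n. f i)"
  by (simp add: mtrace_def mat_diag_def)

lemma eigenbasis_mtrace:
  assumes A: "A \<in> carrier_mat n n" and "eigenbasis n A u l"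
  shows "mtrace A = complex_of_real (\<Sum>i<n. l i)"
    "mtrace (A * A) = complex_of_real (\<Sum>i<n. (l i)\<^sup>2)"
proof -
  define U where "U = columns n n u"
  define D where "D = mat_diag n (\<lambda>i. complex_of_real (l i))"
  have U: "U \<in> carrier_mat n n" and D: "D \<in> carrier_mat n n" by (auto simp: U_def D_def)
  note dec = eigenbasis_decomposition[OF assms, folded U_def D_def]
  show "mtrace A = complex_of_real (\<Sum>i<n. l i)"
    by (subst dec(4), subst mtrace_conjugate_unitary[OF U dec(1) D])
      (simp add: D_def mtrace_mat_diag)
  have "A * A = A * (U * (D * mat_adjoint U))"
    by (subst (2) dec(4), subst assoc_mult_mat[of _ n n _ n _ n]) (use U D in auto)
  also have "\<dots> = A * U * (D * mat_adjoint U)"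
    by (rule assoc_mult_mat[of _ n n _ n _ n, symmetric]) (use A U D in auto)
  also have "\<dots> = U * D * D * mat_adjoint U"
    unfolding dec(3) by (rule assoc_mult_mat[of _ n n _ n _ n, symmetric]) (use A U D in auto)
  also have "U * D * D = U * (D * D)"
    by (rule assoc_mult_mat[of _ n n _ n _ n]) (use U D in auto)
  finally have "mtrace (A * A) = mtrace (D * D)"
    using mtrace_conjugate_unitary[OF U dec(1), of "D * D"] D by simp
  then show "mtrace (A * A) = complex_of_real (\<Sum>i<n. (l i)\<^sup>2)"
    by (simp add: D_def mtrace_mat_diag mat_diag_diag power2_eq_square)
qed

text \<open>The witness is the coordinate vector \<open>mat_adjoint U *\<^sub>v S\<close> of
  \<open>S\<close> in the eigenbasis. Only its squared moduli matter later: they are the weights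
  with which the eigenvalues are averaged.\<close>

lemma eigenbasis_quadratic_form:
  assumes A: "A \<in> carrier_mat n n" and "eigenbasis n A u l" and S: "S \<in> carrier_vec n"
  shows "\<exists>x. (A *\<^sub>v S) \<bullet>c S = complex_of_real (\<Sum>i<n. l i * (cmod (x i))\<^sup>2) \<and>
    S \<bullet>c S = complex_of_real (\<Sum>i<n. (cmod (x i))\<^sup>2)"
proof -
  define U where "U = columns n n u"
  define D where "D = mat_diag n (\<lambda>i. complex_of_real (l i))"
  have U: "U \<in> carrier_mat n n" and D: "D \<in> carrier_mat n n" by (auto simp: U_def D_def)
  note dec = eigenbasis_decomposition[OF assms(1,2), folded U_def D_def]
  define x where "x = mat_adjoint U *\<^sub>v S"
  have x: "x \<in> carrier_vec n"
    unfolding x_def by (rule mult_mat_vec_carrier[of _ n n]) (use U S in auto)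
  have "A *\<^sub>v S = (U * D * mat_adjoint U) *\<^sub>v S"
    using dec(4) by simp
  also have "\<dots> = (U * D) *\<^sub>v x"
    unfolding x_def by (rule assoc_mult_mat_vec[of _ n n _ n]) (use U D S in auto)
  also have "\<dots> = U *\<^sub>v (D *\<^sub>v x)"
    by (rule assoc_mult_mat_vec[of _ n n _ n]) (use U D x in auto)
  finally have "(A *\<^sub>v S) \<bullet>c S = (U *\<^sub>v (D *\<^sub>v x)) \<bullet>c S" by simp
  also have "\<dots> = (D *\<^sub>v x) \<bullet>c x"
    unfolding x_def
    by (rule cscalar_prod_adjoint[OF U _ S], rule mult_mat_vec_carrier[OF D])
      (use x in \<open>simp add: x_def\<close>)
  also have "D *\<^sub>v x = vec n (\<lambda>i. complex_of_real (l i) * x $ i)"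
    using x by (intro eq_vecI)
      (auto simp: D_def mat_diag_def scalar_prod_def if_distrib if_distribR cong: if_cong)
  also have "\<dots> \<bullet>c x = complex_of_real (\<Sum>i<n. l i * (cmod (x $ i))\<^sup>2)"
    using x by (simp add: scalar_prod_def atLeast0LessThan complex_norm_square mult.assoc
        del: of_real_power)
  finally have 1: "(A *\<^sub>v S) \<bullet>c S = complex_of_real (\<Sum>i<n. l i * (cmod (x $ i))\<^sup>2)" .
  have "S = U *\<^sub>v x"
    unfolding x_def
    by (subst assoc_mult_mat_vec[of _ n n _ n, symmetric]) (use U S dec(2) in auto)
  then have "S \<bullet>c S = (U *\<^sub>v x) \<bullet>c S" by simp
  also have "\<dots> = x \<bullet>c x"
    unfolding x_def
    by (rule cscalar_prod_adjoint[OF U _ S]) (use x in \<open>simp add: x_def\<close>)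
  also have "\<dots> = complex_of_real (\<Sum>i<n. (cmod (x $ i))\<^sup>2)"
    using x vec_norm_square[of x] by simp
  finally show ?thesis using 1 by blast
qed

section \<open>Extreme textures and extreme eigenvalues\<close>

text \<open>The double sum in the texture adds up all entries of
  \<open>mat_adjoint M * A * M\<close>, where \<open>M\<close> has the basis as columns. Adding up
  all entries means evaluating the form at the all-ones vector \<open>e\<close>, and moving
  \<open>M\<close> across the scalar product leaves the form of \<open>A\<close> at
  \<open>S = M e\<close>. The norm of \<open>S\<close> is that of \<open>e\<close> because
  \<open>M\<close> is an isometry.\<close>

lemma texture_as_quadratic_form:
  assumes A: "A \<in> carrier_mat n n" and "orthonormal_basis n b"
  defines "S \<equiv> columns n n b *\<^sub>v vec n (\<lambda>_. 1)"
  shows "S \<in> carrier_vec n" "S \<bullet>c S = of_nat n"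
    "texture n b A = 1 - (1 / real n) * Re ((A *\<^sub>v S) \<bullet>c S)"
proof -
  define M where "M = columns n n b"
  define e where "e = vec n (\<lambda>_. 1 :: complex)"
  have M: "M \<in> carrier_mat n n" and e: "e \<in> carrier_vec n" by (auto simp: M_def e_def)
  have b: "\<And>i. i < n \<Longrightarrow> b i \<in> carrier_vec n" and iso: "mat_adjoint M * M = 1\<^sub>m n"
    using assms by (auto simp: orthonormal_basis_iff M_def)
  have S: "S = M *\<^sub>v e" by (simp add: S_def M_def e_def)
  show Sc: "S \<in> carrier_vec n"
    unfolding S by (rule mult_mat_vec_carrier[OF M e])
  have pull: "x \<bullet>c S = (mat_adjoint M *\<^sub>v x) \<bullet>c e" if "x \<in> carrier_vec n" for x
    using cscalar_prod_adjoint[OF mat_adjoint_carrier[OF M] that e] S by simp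
  have "mat_adjoint M *\<^sub>v S = e"
    unfolding S assoc_mult_mat_vec[OF mat_adjoint_carrier[OF M] M e, symmetric] iso
    using e by simp
  then have "S \<bullet>c S = e \<bullet>c e" using pull[OF Sc] by simp
  then show "S \<bullet>c S = of_nat n" by (simp add: e_def scalar_prod_def)
  have AM: "A * M \<in> carrier_mat n n" by (rule mult_carrier_mat[OF A M])
  have MAM: "mat_adjoint M * (A * M) \<in> carrier_mat n n"
    by (rule mult_carrier_mat[OF mat_adjoint_carrier[OF M] AM])
  have AS: "A *\<^sub>v S = (A * M) *\<^sub>v e"
    unfolding S by (rule assoc_mult_mat_vec[OF A M e, symmetric])
  have "A *\<^sub>v S \<in> carrier_vec n" by (rule mult_mat_vec_carrier[OF A Sc])
  then have "(A *\<^sub>v S) \<bullet>c S = ((mat_adjoint M * (A * M)) *\<^sub>v e) \<bullet>c e"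
    unfolding assoc_mult_mat_vec[OF mat_adjoint_carrier[OF M] AM e] AS[symmetric] by (rule pull)
  also have "\<dots> = (\<Sum>i<n. \<Sum>j<n. (mat_adjoint M * (A * M)) $$ (i, j))"
    using carrier_matD[OF MAM]
    by (auto simp: e_def scalar_prod_def atLeast0LessThan simp del: index_mult_mat(1) intro!: sum.cong)
  also have "\<dots> = (\<Sum>i<n. \<Sum>j<n. (A *\<^sub>v b j) \<bullet>c b i)"
  proof (intro sum.cong refl)
    fix i j assume "i \<in> {..<n}" "j \<in> {..<n}"
    then have ij: "i < n" "j < n" by auto
    have "col (A * M) j = A *\<^sub>v b j" "col M i = b i"
      using ij b by (auto simp: col_mult2[OF A M] M_def)
    then show "(mat_adjoint M * (A * M)) $$ (i, j) = (A *\<^sub>v b j) \<bullet>c b i"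
      using index_adjoint_mult_col[OF M AM ij] by simp
  qed
  finally show "texture n b A = 1 - (1 / real n) * Re ((A *\<^sub>v S) \<bullet>c S)"
    by (simp add: texture_def)
qed

text \<open>A geometric sum. For \<open>j\<close> different from \<open>k\<close>, its ratio
  \<open>cis t\<close> is an \<open>n\<close>-th root of unity other than 1, because
  \<open>j - k\<close> is not a multiple of \<open>n\<close>.\<close>

lemma sum_roots_of_unity:
  assumes "j < n" "k < n"
  shows "(\<Sum>i<n. cis (2 * pi * real i * (real j - real k) / real n)) = (if j = k then of_nat n else 0)"
proof (cases "j = k")
  case False
  define t where "t = 2 * pi * (real j - real k) / real n"
  have n: "n > 0" using assms by simp
  have "cis t \<noteq> 1"
  proof
    assume "cis t = 1"
    then have "cos t = 1" by (simp add: complex_eq_iff)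
    then obtain m :: int where "t = of_int m * 2 * pi" using cos_one_2pi_int by blast
    then have "2 * pi * (real j - real k) = 2 * pi * of_int (m * int n)"
      using n by (simp add: t_def field_simps)
    then have "of_int (int j - int k) = (of_int (m * int n) :: real)"
      using mult_left_cancel[of "2 * pi" "real j - real k" "of_int (m * int n)"] by simp
    then have m: "int j - int k = m * int n" by (simp only: of_int_eq_iff)
    have "\<bar>m * int n\<bar> < int n"
      unfolding m[symmetric] using assms by linarith
    then have "m = 0" using n by (simp add: abs_mult)
    then show False using m False by simp
  qed
  moreover have "cis t ^ n = 1"
  proof -
    have "cis t ^ n = cis (2 * pi * of_int (int j - int k))"
      using n by (simp add: DeMoivre t_def)
    then show ?thesis using cis_multiple_2pi[of "of_int (int j - int k)"] by simp
  qed
  moreover have "(\<Sum>i<n. cis (2 * pi * real i * (real j - real k) / real n)) = (\<Sum>i<n. cis t ^ i)"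
    by (simp add: DeMoivre t_def mult_ac)
  ultimately show ?thesis using False by (simp add: geometric_sum)
qed simp

text \<open>
  The discrete Fourier transform of an orthonormal basis, with frequencies shifted by \<open>k\<close>,
  is an orthonormal basis whose sum is proportional to the \<open>k\<close>-th vector.
\<close>

lemma exists_basis_with_sum:
  assumes u: "orthonormal_basis n u" and k: "k < n"
  obtains b where "orthonormal_basis n b"
    "columns n n b *\<^sub>v vec n (\<lambda>_. 1) = complex_of_real (sqrt (real n)) \<cdot>\<^sub>v u k"
proof -
  define s where "s = 1 / sqrt (real n)"
  have n: "n > 0" using k by simp
  have ss: "s * s * real n = 1" "s * real n = sqrt (real n)"
    using n by (simp_all add: s_def field_simps real_sqrt_mult_self real_div_sqrt)
  \<comment> \<open>The factor \<open>real j - real k\<close> is the frequency of row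
    \<open>j\<close>; row \<open>k\<close> has frequency zero and is therefore constant. The factor
    \<open>s\<close> makes the columns of \<open>F\<close> unit vectors.\<close>
  define \<theta> where "\<theta> j i = 2 * pi * real i * (real j - real k) / real n" for j i
  define F where "F = mat n n (\<lambda>(j, i). complex_of_real s * cis (\<theta> j i))"
  define U where "U = columns n n u"
  have F: "F \<in> carrier_mat n n" and U: "U \<in> carrier_mat n n" by (auto simp: F_def U_def)
  have UF: "U * F \<in> carrier_mat n n" by (rule mult_carrier_mat[OF U F])
  have uc: "\<And>i. i < n \<Longrightarrow> u i \<in> carrier_vec n" and iso: "mat_adjoint U * U = 1\<^sub>m n"
    using u by (auto simp: orthonormal_basis_iff U_def)
  have isoF: "mat_adjoint F * F = 1\<^sub>m n"
  proof (rule eq_matI)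
    fix i l assume "i < dim_row (1\<^sub>m n :: complex mat)" "l < dim_col (1\<^sub>m n :: complex mat)"
    then have il: "i < n" "l < n" by auto
    \<comment> \<open>Splits off the part of the phase that contains \<open>k\<close>. It does not
      depend on the summation index \<open>j\<close>, so the shift contributes only a common factor
      and leaves orthogonality of the columns intact.\<close>
    have \<theta>: "\<theta> j l - \<theta> j i = 2 * pi * real j * (real l - real i) / real n +
        - (2 * pi * real k * (real l - real i) / real n)" for j
      by (simp add: \<theta>_def diff_divide_distrib [symmetric] add_divide_distrib [symmetric] algebra_simps)
    have "(mat_adjoint F * F) $$ (i, l) = (\<Sum>j<n. cnj (F $$ (j, i)) * F $$ (j, l))"
      using il carrier_matD[OF F] by (auto simp: scalar_prod_def atLeast0LessThan)
    also have "\<dots> = (\<Sum>j<n. complex_of_real (s * s) * cis (\<theta> j l - \<theta> j i))"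
    proof (intro sum.cong refl)
      fix j assume "j \<in> {..<n}"
      moreover have "cis (\<theta> j l - \<theta> j i) = cnj (cis (\<theta> j i)) * cis (\<theta> j l)"
        by (simp add: cis_cnj cis_mult)
      ultimately show "cnj (F $$ (j, i)) * F $$ (j, l) = complex_of_real (s * s) * cis (\<theta> j l - \<theta> j i)"
        using il by (simp add: F_def mult_ac)
    qed
    also have "\<dots> = complex_of_real (s * s) * cis (- (2 * pi * real k * (real l - real i) / real n)) *
        (\<Sum>j<n. cis (2 * pi * real j * (real l - real i) / real n))"
      unfolding \<theta> cis_mult[symmetric] by (simp add: sum_distrib_left mult_ac)
    also have "\<dots> = (if l = i then complex_of_real (s * s * real n) else 0)"
      unfolding sum_roots_of_unity[OF il(2,1)] by simp
    finally show "(mat_adjoint F * F) $$ (i, l) = 1\<^sub>m n $$ (i, l)"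
      unfolding ss using il by simp
  qed (use F in auto)
  \<comment> \<open>\<open>F\<close> times the all-ones vector collects the row sums of
    \<open>F\<close>. They vanish except in the constant row \<open>k\<close>, so the columns of
    \<open>U * F\<close> add up to a multiple of \<open>u k\<close>.\<close>
  have Fe: "F *\<^sub>v vec n (\<lambda>_. 1) = complex_of_real (sqrt (real n)) \<cdot>\<^sub>v unit_vec n k"
  proof (rule eq_vecI)
    fix j assume "j < dim_vec (complex_of_real (sqrt (real n)) \<cdot>\<^sub>v unit_vec n k)"
    then have j: "j < n" by simp
    have "(F *\<^sub>v vec n (\<lambda>_. 1)) $ j = complex_of_real s * (\<Sum>i<n. cis (\<theta> j i))"
      using j by (simp add: F_def scalar_prod_def atLeast0LessThan sum_distrib_left)
    also have "\<dots> = (if j = k then complex_of_real (s * real n) else 0)"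
      unfolding \<theta>_def sum_roots_of_unity[OF j k] by simp
    finally show "(F *\<^sub>v vec n (\<lambda>_. 1)) $ j = (complex_of_real (sqrt (real n)) \<cdot>\<^sub>v unit_vec n k) $ j"
      unfolding ss using j k by simp
  qed (use F in auto)
  have "mat_adjoint (U * F) * (U * F) = mat_adjoint F * (mat_adjoint U * (U * F))"
    unfolding mat_adjoint_mult[OF U F]
    by (rule assoc_mult_mat[OF mat_adjoint_carrier[OF F] mat_adjoint_carrier[OF U] UF])
  also have "mat_adjoint U * (U * F) = F"
    unfolding assoc_mult_mat[OF mat_adjoint_carrier[OF U] U F, symmetric] iso
    by (rule left_mult_one_mat[OF F])
  finally have "mat_adjoint (U * F) * (U * F) = 1\<^sub>m n" unfolding isoF .
  then have "orthonormal_basis n (col (U * F))"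
    unfolding orthonormal_basis_iff columns_col[OF UF] using UF by auto
  moreover have "columns n n (col (U * F)) *\<^sub>v vec n (\<lambda>_. 1) = complex_of_real (sqrt (real n)) \<cdot>\<^sub>v u k"
  proof -
    have "columns n n (col (U * F)) *\<^sub>v vec n (\<lambda>_. 1) =
        U *\<^sub>v (complex_of_real (sqrt (real n)) \<cdot>\<^sub>v unit_vec n k)"
      unfolding columns_col[OF UF] Fe[symmetric] by (rule assoc_mult_mat_vec[OF U F]) simp
    also have "\<dots> = complex_of_real (sqrt (real n)) \<cdot>\<^sub>v (U *\<^sub>v unit_vec n k)"
      by (rule mult_mat_vec[OF U]) simp
    also have "U *\<^sub>v unit_vec n k = u k"
      using uc[OF k] k U by (intro eq_vecI) (auto simp: U_def columns_def)
    finally show ?thesis .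
  qed
  ultimately show ?thesis by (rule that)
qed

text \<open>The squared coordinates of \<open>S\<close> in the eigenbasis sum to \<open>n\<close>,
  so 1 minus the texture is a weighted mean of the eigenvalues and lies between the extreme
  ones.\<close>

lemma texture_bounds:
  assumes A: "A \<in> carrier_mat n n" and "eigenbasis n A u l" and "orthonormal_basis n b" and "n > 0"
  shows "texture n b A \<le> 1 - Min (l ` {..<n})" "1 - Max (l ` {..<n}) \<le> texture n b A"
proof -
  define S where "S = columns n n b *\<^sub>v vec n (\<lambda>_. 1)"
  note S = texture_as_quadratic_form[OF A assms(3), folded S_def]
  obtain x where x: "(A *\<^sub>v S) \<bullet>c S = complex_of_real (\<Sum>i<n. l i * (cmod (x i))\<^sup>2)"
    "S \<bullet>c S = complex_of_real (\<Sum>i<n. (cmod (x i))\<^sup>2)"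
    using eigenbasis_quadratic_form[OF A assms(2) S(1)] by blast
  have "complex_of_real (\<Sum>i<n. (cmod (x i))\<^sup>2) = complex_of_real (real n)"
    using x(2) S(2) by simp
  then have norm: "(\<Sum>i<n. (cmod (x i))\<^sup>2) = real n" by (simp only: of_real_eq_iff)
  have t: "texture n b A = 1 - (\<Sum>i<n. l i * (cmod (x i))\<^sup>2) / real n"
    unfolding S(3) x(1) by simp
  have "Min (l ` {..<n}) * real n = (\<Sum>i<n. Min (l ` {..<n}) * (cmod (x i))\<^sup>2)"
    by (simp add: norm sum_distrib_left[symmetric])
  also have "\<dots> \<le> (\<Sum>i<n. l i * (cmod (x i))\<^sup>2)"
    by (intro sum_mono mult_right_mono) auto
  finally show "texture n b A \<le> 1 - Min (l ` {..<n})"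
    unfolding t using \<open>n > 0\<close> by (simp add: field_simps)
  have "(\<Sum>i<n. l i * (cmod (x i))\<^sup>2) \<le> (\<Sum>i<n. Max (l ` {..<n}) * (cmod (x i))\<^sup>2)"
    by (intro sum_mono mult_right_mono) auto
  also have "\<dots> = Max (l ` {..<n}) * real n"
    by (simp add: norm sum_distrib_left[symmetric])
  finally show "1 - Max (l ` {..<n}) \<le> texture n b A"
    unfolding t using \<open>n > 0\<close> by (simp add: field_simps)
qed

lemma texture_attains_eigenvalue:
  assumes A: "A \<in> carrier_mat n n" and "eigenbasis n A u l" and k: "k < n"
  obtains b where "orthonormal_basis n b" "texture n b A = 1 - l k"
proof -
  have u: "orthonormal_basis n u" and eig: "A *\<^sub>v u k = complex_of_real (l k) \<cdot>\<^sub>v u k"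
    using assms by (auto simp: eigenbasis_def)
  then have uk: "u k \<in> carrier_vec n" "u k \<bullet>c u k = 1"
    using k by (auto simp: orthonormal_basis_def)
  obtain b where b: "orthonormal_basis n b"
    "columns n n b *\<^sub>v vec n (\<lambda>_. 1) = complex_of_real (sqrt (real n)) \<cdot>\<^sub>v u k"
    using exists_basis_with_sum[OF u k] by blast
  have "(A *\<^sub>v (complex_of_real (sqrt (real n)) \<cdot>\<^sub>v u k)) \<bullet>c (complex_of_real (sqrt (real n)) \<cdot>\<^sub>v u k)
      = complex_of_real (sqrt (real n) * sqrt (real n) * l k)"
    unfolding mult_mat_vec[OF A uk(1)] eig using uk
    by (simp add: conjugate_smult_vec mult_ac del: real_sqrt_mult_self)
  then have "texture n b A = 1 - l k"
    unfolding texture_as_quadratic_form(3)[OF A b(1)] b(2) using k by simp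
  then show ?thesis using b(1) that by blast
qed

lemma texture_extrema:
  assumes A: "A \<in> carrier_mat n n" and eb: "eigenbasis n A u l" and "n > 0"
  shows "texture_max n A = 1 - Min (l ` {..<n})" "texture_min n A = 1 - Max (l ` {..<n})"
proof -
  \<comment> \<open>Stated for an arbitrary element of the spectrum, so that it serves both
    \<open>Min\<close> and \<open>Max\<close>. The largest texture belongs to the smallest
    eigenvalue and vice versa.\<close>
  have attained: "\<exists>b. orthonormal_basis n b \<and> 1 - t = texture n b A" if "t \<in> l ` {..<n}" for t
    using that texture_attains_eigenvalue[OF A eb] by (metis imageE lessThan_iff)
  have ne: "l ` {..<n} \<noteq> {}" using \<open>n > 0\<close> by auto
  show "texture_max n A = 1 - Min (l ` {..<n})"
    unfolding texture_max_def
    by (rule Greatest_equality) (use texture_bounds(1)[OF A eb _ \<open>n > 0\<close>] attained[OF Min_in] ne in auto)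
  show "texture_min n A = 1 - Max (l ` {..<n})"
    unfolding texture_min_def
    by (rule Least_equality) (use texture_bounds(2)[OF A eb _ \<open>n > 0\<close>] attained[OF Max_in] ne in auto)
qed

section \<open>The entropy inequality as a statement about spectra\<close>

text \<open>The mean of the \<open>l m\<close> is \<open>c = 1 / n\<close>, so the sum of squares
  exceeds \<open>c\<close> by the sum of squared deviations from the mean. Keeping only the
  deviations at \<open>i\<close> and \<open>j\<close> bounds that sum from below.\<close>

lemma sum_squares_ge_spread:
  fixes l :: "nat \<Rightarrow> real"
  assumes "i < n" "j < n" and sum: "(\<Sum>m<n. l m) = 1"
  shows "1 + real n * (l i - l j)\<^sup>2 / 2 \<le> real n * (\<Sum>m<n. (l m)\<^sup>2)"
proof -
  have n: "n > 0" using assms by simp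
  define c where "c = 1 / real n"
  have nc: "real n * c = 1" using n by (simp add: c_def)
  have "(\<Sum>m<n. (l m - c)\<^sup>2) = (\<Sum>m<n. (l m)\<^sup>2) - 2 * c * (\<Sum>m<n. l m) + real n * c\<^sup>2"
    by (simp add: power2_diff sum.distrib sum_subtractf sum_distrib_left mult_ac)
  then have var: "(\<Sum>m<n. (l m - c)\<^sup>2) = (\<Sum>m<n. (l m)\<^sup>2) - c"
    using sum nc by (simp add: power2_eq_square flip: mult.assoc)
  have "(l i - l j)\<^sup>2 / 2 \<le> (\<Sum>m<n. (l m - c)\<^sup>2)"
  proof (cases "i = j")
    case True
    then show ?thesis by (simp add: sum_nonneg)
  next
    case False
    \<comment> \<open>For the deviations a and b at \<open>i\<close> and \<open>j\<close>,
      nonnegativity of the square of a + b rearranges to the bound of half the square of a - b by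
      the sum of their squares.\<close>
    have "0 \<le> ((l i - c) + (l j - c))\<^sup>2" by simp
    then have "(l i - l j)\<^sup>2 / 2 \<le> (l i - c)\<^sup>2 + (l j - c)\<^sup>2"
      by (simp add: power2_eq_square field_simps)
    also have "\<dots> = (\<Sum>m\<in>{i, j}. (l m - c)\<^sup>2)" using False by simp
    also have "\<dots> \<le> (\<Sum>m<n. (l m - c)\<^sup>2)"
      using assms by (intro sum_mono2) auto
    finally show ?thesis .
  qed
  then have "real n * ((l i - l j)\<^sup>2 / 2) \<le> real n * ((\<Sum>m<n. (l m)\<^sup>2) - c)"
    unfolding var by (intro mult_left_mono) auto
  then show ?thesis using nc by (simp add: right_diff_distrib)
qed

lemma density_matrix_pos: "density_matrix n A \<Longrightarrow> n > 0"
  by (cases n) (auto simp: density_matrix_def mtrace_def)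

text \<open>Expresses both purities through one list of real numbers with sum 1, after which no
  matrices are needed for the inequality or for the qubit case.\<close>

lemma density_matrix_spectrum:
  assumes "density_matrix n A"
  obtains l :: "nat \<Rightarrow> real" where "(\<Sum>i<n. l i) = 1"
    "renyi2_purity n A = log 2 (real n * (\<Sum>i<n. (l i)\<^sup>2))"
    "texture_purity n A = real n * (Max (l ` {..<n}) - Min (l ` {..<n}))"
proof -
  have A: "A \<in> carrier_mat n n" and herm: "mat_adjoint A = A" and tr: "mtrace A = 1"
    using assms by (auto simp: density_matrix_def)
  obtain u l where eb: "eigenbasis n A u l"
    using hermitian_eigenbasis[OF A herm] by blast
  have "complex_of_real (\<Sum>i<n. l i) = 1"
    using tr unfolding eigenbasis_mtrace(1)[OF A eb] .
  then have "(\<Sum>i<n. l i) = 1" by (simp only: of_real_eq_1_iff)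
  moreover have "renyi2_purity n A = log 2 (real n * (\<Sum>i<n. (l i)\<^sup>2))"
    unfolding renyi2_purity_eq[OF assms] eigenbasis_mtrace(2)[OF A eb] by simp
  moreover have "texture_purity n A = real n * (Max (l ` {..<n}) - Min (l ` {..<n}))"
    unfolding texture_purity_def texture_extrema[OF A eb density_matrix_pos[OF assms]] by simp
  ultimately show ?thesis by (rule that)
qed

lemma renyi2_purity_lower_bound:
  assumes "density_matrix n A"
  shows "log 2 (1 + (texture_purity n A)\<^sup>2 / (2 * real n)) \<le> renyi2_purity n A"
proof -
  obtain l :: "nat \<Rightarrow> real" where l: "(\<Sum>i<n. l i) = 1"
    "renyi2_purity n A = log 2 (real n * (\<Sum>i<n. (l i)\<^sup>2))"
    "texture_purity n A = real n * (Max (l ` {..<n}) - Min (l ` {..<n}))"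
    using density_matrix_spectrum[OF assms] by blast
  have n: "n > 0" by (rule density_matrix_pos[OF assms])
  then have "Max (l ` {..<n}) \<in> l ` {..<n}" "Min (l ` {..<n}) \<in> l ` {..<n}"
    by (auto intro!: Max_in Min_in)
  then obtain i j where ij: "i < n" "j < n" "Max (l ` {..<n}) = l i" "Min (l ` {..<n}) = l j"
    by auto
  have "(texture_purity n A)\<^sup>2 / (2 * real n) = real n * (l i - l j)\<^sup>2 / 2"
    unfolding l(3) ij using n by (simp add: power2_eq_square)
  then have "1 + (texture_purity n A)\<^sup>2 / (2 * real n) \<le> real n * (\<Sum>i<n. (l i)\<^sup>2)"
    using sum_squares_ge_spread[OF ij(1,2) l(1)] by simp
  moreover have "0 < 1 + (texture_purity n A)\<^sup>2 / (2 * real n)"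
    by (rule add_pos_nonneg) auto
  ultimately show ?thesis unfolding l(2) by (intro log_mono) auto
qed

text \<open>Twice the sum of the squares of two numbers is the square of their sum plus the square
  of their difference. Here the sum is 1 and the difference is, up to sign, half the texture
  purity.\<close>

lemma renyi2_purity_qubit:
  assumes "density_matrix 2 A"
  shows "renyi2_purity 2 A = log 2 (1 + (texture_purity 2 A)\<^sup>2 / (2 * real 2))"
proof -
  obtain l :: "nat \<Rightarrow> real" where l: "(\<Sum>i<2. l i) = 1"
    "renyi2_purity 2 A = log 2 (real 2 * (\<Sum>i<2. (l i)\<^sup>2))"
    "texture_purity 2 A = real 2 * (Max (l ` {..<2}) - Min (l ` {..<2}))"
    using density_matrix_spectrum[OF assms] by blast
  have two: "{..<2} = {0, 1 :: nat}" by auto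
  have l1: "l (Suc 0) = 1 - l 0" using l(1) by (simp add: two)
  have "(max (l 0) (l 1) - min (l 0) (l 1))\<^sup>2 = (l 0 - l 1)\<^sup>2"
    by (auto simp: max_def min_def power2_commute)
  moreover have "texture_purity 2 A = 2 * (max (l 0) (l 1) - min (l 0) (l 1))"
    unfolding l(3) by (simp add: two)
  ultimately have "1 + (texture_purity 2 A)\<^sup>2 / (2 * real 2) = 1 + (l 0 - l 1)\<^sup>2"
    by (simp only: power_mult_distrib) simp
  also have "\<dots> = real 2 * (\<Sum>i<2. (l i)\<^sup>2)"
    unfolding two by (simp add: l1 power2_eq_square algebra_simps)
  finally show ?thesis unfolding l(2) by simp
qed

section \<open>Restriction to the support\<close>

text \<open>A maximal independent set of columns has \<open>r\<close> elements and spans all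
  columns. Orthonormalizing it gives an isometry \<open>V\<close> whose range contains every column,
  so \<open>A = V * X\<close> for some \<open>X\<close>, and \<open>V * mat_adjoint V\<close> fixes
  \<open>A\<close>.\<close>

lemma exists_range_isometry:
  fixes A :: "complex mat"
  assumes A: "A \<in> carrier_mat n m" and r: "vec_space.rank n A = r"
  obtains V where "V \<in> carrier_mat n r" "mat_adjoint V * V = 1\<^sub>m r" "V * mat_adjoint V * A = A"
proof -
  interpret cof_vec_space n "TYPE(complex)" .
  define C where "C = set (cols A)"
  have C: "C \<subseteq> carrier_vec n" "finite C"
    using A cols_dim[of A] by (auto simp: C_def)
  obtain S where S: "finite S" "maximal S (\<lambda>T. T \<subseteq> C \<and> lin_indpt T)"
  proof -
    have "lin_indpt {}" by (simp add: lin_dep_def)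
    then show ?thesis
      using maximal_exists_superset[of C "\<lambda>T. T \<subseteq> C \<and> lin_indpt T" "{}"] C that by blast
  qed
  then have SC: "S \<subseteq> C" and indep: "lin_indpt S" by (auto simp: maximal_def)
  then have Sc: "S \<subseteq> carrier_vec n" using C by blast
  have card: "card S = r" using rank_card_indpt[OF A] S r by (simp add: C_def)
  have CS: "v \<in> span S" if v: "v \<in> C" for v
  proof (rule ccontr)
    assume nv: "v \<notin> span S"
    then have "v \<notin> S" using span_mem[of S v] Sc by auto
    moreover have "lin_indpt (insert v S)"
      using lin_dep_iff_in_span[of S v] Sc indep v C nv \<open>v \<notin> S\<close> by auto
    ultimately show False
      using S(2) v SC unfolding maximal_def by blast
  qed
  obtain ws where ws: "set ws = S" "distinct ws"
    using finite_distinct_list[OF S(1)] by blast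
  define us where "us = gram_schmidt n ws"
  have gs: "span S = span (set us)" "corthogonal us" "set us \<subseteq> carrier_vec n" "length us = length ws"
    using gram_schmidt_result[of ws us] ws Sc indep by (auto simp: us_def)
  have len: "length us = r" using gs(4) ws card distinct_card[of ws] by simp
  have us: "us ! i \<in> carrier_vec n" if "i < r" for i using gs(3) len that by auto
  \<comment> \<open>The Gram-Schmidt vectors are only orthogonal and nonzero; the factors
    \<open>c i\<close> normalize them.\<close>
  have "\<exists>c. c \<noteq> 0 \<and> (c \<cdot>\<^sub>v us ! i) \<bullet>c (c \<cdot>\<^sub>v us ! i) = 1" if i: "i < r" for i
  proof -
    have "us ! i \<bullet>c us ! i \<noteq> 0" using corthogonalD[OF gs(2), of i i] i len by simp
    then have "us ! i \<noteq> 0\<^sub>v n" using conjugate_square_eq_0_vec[OF us[OF i]] by blast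
    then show ?thesis using exists_normalized[OF us[OF i]] by blast
  qed
  then obtain c where c: "\<And>i. i < r \<Longrightarrow> c i \<noteq> 0"
    "\<And>i. i < r \<Longrightarrow> (c i \<cdot>\<^sub>v us ! i) \<bullet>c (c i \<cdot>\<^sub>v us ! i) = 1"
    by metis
  define V where "V = columns n r (\<lambda>i. c i \<cdot>\<^sub>v us ! i)"
  have V: "V \<in> carrier_mat n r" by (simp add: V_def)
  have iso: "mat_adjoint V * V = 1\<^sub>m r"
  proof -
    have "(c i \<cdot>\<^sub>v us ! i) \<bullet>c (c j \<cdot>\<^sub>v us ! j) = (if i = j then 1 else 0)" if "i < r" "j < r" for i j
    proof (cases "i = j")
      case False
      then have "us ! i \<bullet>c us ! j = 0" using corthogonalD[OF gs(2), of i j] that len by simp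
      then show ?thesis using us[OF that(1)] us[OF that(2)] False by (simp add: conjugate_smult_vec)
    qed (use c(2) that in simp)
    then show ?thesis
      unfolding V_def using adjoint_columns_mult_columns[of r "\<lambda>i. c i \<cdot>\<^sub>v us ! i" n] us by auto
  qed
  have "\<exists>x \<in> carrier_vec r. col A j = V *\<^sub>v x" if j: "j < m" for j
  proof -
    have "col A j \<in> span_list us"
      using CS[of "col A j"] j A gs(1) span_list_as_span[OF gs(3)] by (auto simp: C_def cols_def)
    then obtain a where a: "col A j = lincomb_list a us" using in_span_listE by blast
    have "lincomb_list a us = mat_of_cols n us *\<^sub>v vec r a"
      unfolding len[symmetric] by (rule lincomb_list_as_mat_mult) (use gs(3) in auto)
    \<comment> \<open>The coefficients are divided by \<open>c i\<close> to undo the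
      normalization.\<close>
    also have "\<dots> = V *\<^sub>v vec r (\<lambda>i. a i / c i)"
      using c(1) len carrier_vecD[OF us]
      by (intro eq_vecI)
        (auto simp: V_def columns_def mat_of_cols_def scalar_prod_def intro!: sum.cong)
    finally show ?thesis using a by auto
  qed
  then obtain x where x: "\<And>j. j < m \<Longrightarrow> x j \<in> carrier_vec r" "\<And>j. j < m \<Longrightarrow> col A j = V *\<^sub>v x j"
    by metis
  define X where "X = columns r m x"
  have X: "X \<in> carrier_mat r m" by (simp add: X_def)
  have AX: "A = V * X"
  proof (rule eq_matI)
    fix i j assume "i < dim_row (V * X)" "j < dim_col (V * X)"
    then have ij: "i < n" "j < m" using V X by auto
    have "A $$ (i, j) = col A j $ i" using A ij by simp
    also have "\<dots> = (V * X) $$ (i, j)"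
      unfolding x(2)[OF ij(2)] using ij V X x(1)[OF ij(2)] by (simp add: X_def)
    finally show "A $$ (i, j) = (V * X) $$ (i, j)" .
  qed (use A V X in auto)
  have "V * mat_adjoint V * A = V * (mat_adjoint V * (V * X))"
    unfolding AX by (rule assoc_mult_mat[OF V mat_adjoint_carrier[OF V] mult_carrier_mat[OF V X]])
  also have "mat_adjoint V * (V * X) = X"
    unfolding assoc_mult_mat[OF mat_adjoint_carrier[OF V] V X, symmetric] iso
    by (rule left_mult_one_mat[OF X])
  finally show ?thesis using that V iso AX by simp
qed

text \<open>Hermiticity and positivity pass to any compression by \<open>V\<close>. The trace is
  kept because cyclicity turns it into the trace of \<open>V * mat_adjoint V * \<rho>\<close>, which
  is \<open>\<rho>\<close> when the range of \<open>V\<close> contains that of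
  \<open>\<rho>\<close>.\<close>

lemma density_matrix_restriction:
  assumes \<rho>: "density_matrix n \<rho>" and "restricts_to n r \<rho> \<sigma>"
  shows "density_matrix r \<sigma>"
proof -
  have A: "\<rho> \<in> carrier_mat n n" and herm: "mat_adjoint \<rho> = \<rho>" and tr: "mtrace \<rho> = 1"
    and psd: "\<And>v. v \<in> carrier_vec n \<Longrightarrow> 0 \<le> Re ((\<rho> *\<^sub>v v) \<bullet>c v)"
    using \<rho> by (auto simp: density_matrix_def)
  obtain V where V: "V \<in> carrier_mat n r" and range: "V * mat_adjoint V * \<rho> = \<rho>"
    and \<sigma>: "\<sigma> = mat_adjoint V * \<rho> * V"
    using assms(2) by (auto simp: restricts_to_def)
  note V' = mat_adjoint_carrier[OF V]
  note AV = mult_carrier_mat[OF A V]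
  note VA = mult_carrier_mat[OF V' A]
  have \<sigma>': "\<sigma> = mat_adjoint V * (\<rho> * V)" unfolding \<sigma> by (rule assoc_mult_mat[OF V' A V])
  have "\<sigma> \<in> carrier_mat r r" unfolding \<sigma> by (rule mult_carrier_mat[OF VA V])
  moreover have "mat_adjoint \<sigma> = \<sigma>"
  proof -
    have "mat_adjoint \<sigma> = mat_adjoint (\<rho> * V) * V"
      unfolding \<sigma>' mat_adjoint_mult[OF V' AV] by simp
    then show ?thesis unfolding mat_adjoint_mult[OF A V] herm \<sigma> .
  qed
  moreover have "0 \<le> Re ((\<sigma> *\<^sub>v v) \<bullet>c v)" if v: "v \<in> carrier_vec r" for v
  proof -
    have Vv: "V *\<^sub>v v \<in> carrier_vec n" by (rule mult_mat_vec_carrier[OF V v])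
    have "\<sigma> *\<^sub>v v = mat_adjoint V *\<^sub>v (\<rho> *\<^sub>v (V *\<^sub>v v))"
      unfolding \<sigma> assoc_mult_mat_vec[OF VA V v] by (rule assoc_mult_mat_vec[OF V' A Vv])
    then have "(\<sigma> *\<^sub>v v) \<bullet>c v = (\<rho> *\<^sub>v (V *\<^sub>v v)) \<bullet>c (V *\<^sub>v v)"
      using cscalar_prod_adjoint[OF V' mult_mat_vec_carrier[OF A Vv] v] by simp
    then show ?thesis using psd[OF Vv] by simp
  qed
  moreover have "mtrace \<sigma> = 1"
  proof -
    have "mtrace \<sigma> = mtrace (V * (mat_adjoint V * \<rho>))"
      unfolding \<sigma> by (rule mtrace_mult_commute[OF VA V])
    also have "V * (mat_adjoint V * \<rho>) = \<rho>"
      using range unfolding assoc_mult_mat[OF V V' A] .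
    finally show ?thesis using tr by simp
  qed
  ultimately show ?thesis by (auto simp: density_matrix_def)
qed

text \<open>The rank-2 equality concerns the operator on the two-dimensional support. In the ambient
  space it can fail: for \<open>d = 3\<close> and spectrum 1/2, 1/2, 0, the logarithms are taken of
  3/2 and 11/8. The existence claim keeps the statement about all \<open>\<sigma>\<close> from being
  vacuous.\<close>

theorem proposition2:
  fixes d :: nat and \<rho> :: "complex mat"
  assumes "density_matrix d \<rho>"
  shows "renyi2_purity d \<rho> \<ge> log 2 (1 + (texture_purity d \<rho>)\<^sup>2 / (2 * real d)) \<and>
    (d = 2 \<longrightarrow>
      renyi2_purity d \<rho> = log 2 (1 + (texture_purity d \<rho>)\<^sup>2 / (2 * real d))) \<and>
    (vec_space.rank d \<rho> = 2 \<longrightarrow>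
      (\<exists>\<sigma>. restricts_to d 2 \<rho> \<sigma>) \<and>
      (\<forall>\<sigma>. restricts_to d 2 \<rho> \<sigma> \<longrightarrow> density_matrix 2 \<sigma> \<and>
        renyi2_purity 2 \<sigma> = log 2 (1 + (texture_purity 2 \<sigma>)\<^sup>2 / (2 * real 2))))"
proof (intro conjI impI allI)
  show "log 2 (1 + (texture_purity d \<rho>)\<^sup>2 / (2 * real d)) \<le> renyi2_purity d \<rho>"
    by (rule renyi2_purity_lower_bound[OF assms])
  show "renyi2_purity d \<rho> = log 2 (1 + (texture_purity d \<rho>)\<^sup>2 / (2 * real d))" if "d = 2"
    using renyi2_purity_qubit assms that by blast
  show "\<exists>\<sigma>. restricts_to d 2 \<rho> \<sigma>" if "vec_space.rank d \<rho> = 2"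
    using exists_range_isometry[OF _ that] assms
    by (metis density_matrix_def restricts_to_def)
  fix \<sigma> assume "restricts_to d 2 \<rho> \<sigma>"
  then show "density_matrix 2 \<sigma>" by (rule density_matrix_restriction[OF assms])
  then show "renyi2_purity 2 \<sigma> = log 2 (1 + (texture_purity 2 \<sigma>)\<^sup>2 / (2 * real 2))"
    by (rule renyi2_purity_qubit)
qed

end
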